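(* Let $m\ge 2$ and $k\in\mathbb{N}$, and let $n\ge 0$ satisfy $n\equiv i\pmod m$ with $i\in\{0,\ldots,m-1\}$. Then \[ a_m(k,n)\le\left(\frac{m}{m-1}\right)^{\lfloor (k-i)/m\rfloor}\prod_{j=0}^{\lfloor (k-i)/m\rfloor-1}(k-i-jm). \] In particular, for each fixed $k$ the sequence $(a_m(k,n))_{n=0}^{\infty}$ is bounded.
   Context: For integers $m\ge 2$, $k\ge 0$, $n\ge 0$, $a_m(k,n)$ denotes the number of partitions of $n$ into exactly $k$ parts, each part being a power of $m$ (i.e. $a_m(k,n)$ is the coefficient of $t^k$ in $p_m(n,t)$, where $\prod_{j\ge0}\frac{1}{1-tq^{m^j}}=\sum_n p_m(n,t)q^n$). An empty product equals $1$. *)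

theory Defs
  imports Complex_Main "HOL-Library.Multiset" "HOL-Number_Theory.Cong"
begin

definition mary_partitions :: "nat \<Rightarrow> nat \<Rightarrow> nat \<Rightarrow> nat multiset set" where
  "mary_partitions m k n =
     {P. size P = k \<and> sum_mset P = n \<and> (\<forall>x\<in>#P. \<exists>j. x = m ^ j)}"

definition mary_count :: "nat \<Rightarrow> nat \<Rightarrow> nat \<Rightarrow> nat" where
  "mary_count m k n = card (mary_partitions m k n)"

lemma finite_mary_partitions: "finite (mary_partitions m k n)"
proof (rule finite_subset)
  show "mary_partitions m k n \<subseteq> mset ` {xs. set xs \<subseteq> {..n} \<and> length xs = k}"
  proof
    fix P assume P: "P \<in> mary_partitions m k n"
    obtain xs where xs: "mset xs = P" using ex_mset by blast
    have "x \<le> n" if "x \<in># P" for x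
      using P multi_member_split[OF that] by (auto simp: mary_partitions_def)
    moreover have "length xs = k"
      using P xs by (auto simp: mary_partitions_def)
    ultimately show "P \<in> mset ` {xs. set xs \<subseteq> {..n} \<and> length xs = k}"
      using xs by auto
  qed
  show "finite (mset ` {xs. set xs \<subseteq> {..n} \<and> length xs = k})"
    by (intro finite_imageI finite_lists_length_eq) simp
qed

end

theory Submission
  imports Defs
begin

text \<open>
  Write \<open>a(k,n)\<close> for the number of partitions.  Removing a part \<open>1\<close>, or dividing all parts by \<open>m\<close>
  when there is none, gives a recursion that shows \<open>a(k,n) = a(k-i,n-i)\<close> for \<open>n \<equiv> i\<close> and
  \<open>a(k,mN) = a(k,N) + a(k-m,m(N-1))\<close>.  If \<open>n = m\<^sup>s M\<close> with \<open>m\<close> not dividing \<open>M\<close>, iteration yields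
  \<open>a(k,n) = a(k,M) + \<Sum>\<^sub>t a(k-m, m\<^sup>t M - m)\<close> with \<open>1 \<le> t \<le> s\<close>.  The lowest base-\<open>m\<close> digits of
  \<open>m\<^sup>t\<^sup>-\<^sup>1 M - 1\<close> are \<open>t-1\<close> copies of \<open>m-1\<close>, so only the terms with \<open>(t-1)(m-1) \<le> k-m\<close> survive, at
  most \<open>(k-1)/(m-1)\<close> of them.  Hence \<open>a(k,n) \<le> B(k)\<close>, where \<open>B\<close> is the monotone sequence with
  \<open>B(k) = 1\<close> for \<open>k < m\<close> and \<open>B(k) = B(k-1) + \<lfloor>(k-1)/(m-1)\<rfloor> B(k-m)\<close> otherwise.  Adding up \<open>m\<close>
  consecutive increments gives \<open>(m-1) B(k) \<le> m k B(k-m)\<close>, which unrolls to the claimed product.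
\<close>

section \<open>Splitting partitions by the presence of a part 1\<close>

lemma mary_partitions_with_one:
  "{P \<in> mary_partitions m (Suc k) (Suc n). 1 \<in># P} = add_mset 1 ` mary_partitions m k n"
proof (intro equalityI subsetI)
  fix P assume P: "P \<in> {P \<in> mary_partitions m (Suc k) (Suc n). 1 \<in># P}"
  then obtain Q where "P = add_mset 1 Q" by (auto dest: multi_member_split)
  with P show "P \<in> add_mset 1 ` mary_partitions m k n"
    by (auto simp: mary_partitions_def)
next
  fix P assume "P \<in> add_mset 1 ` mary_partitions m k n"
  moreover have "\<exists>j. Suc 0 = m ^ j" by (rule exI[of _ 0]) simp
  ultimately show "P \<in> {P \<in> mary_partitions m (Suc k) (Suc n). 1 \<in># P}"
    by (auto simp: mary_partitions_def)
qed

lemma part_of_mary_partition_without_one: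
  assumes "P \<in> mary_partitions m k n" "1 \<notin># P" "x \<in># P"
  shows "\<exists>j. x = m * m ^ j"
proof -
  obtain j where j: "x = m ^ j" using assms by (auto simp: mary_partitions_def)
  with assms show ?thesis by (cases j) auto
qed

lemma sum_mset_image_mult: "sum_mset (image_mset ((*) c) P) = c * sum_mset P"
  for c :: "'a :: semiring_0"
  using sum_mset_distrib_left[of c "\<lambda>x. x" P] by simp

text \<open>A power of \<open>m\<close> other than 1 is \<open>m\<close> times a power of
  \<open>m\<close>, so dividing every part by \<open>m\<close> inverts the multiplication.\<close>

lemma mary_partitions_without_one:
  assumes "m \<ge> 2"
  shows "{P \<in> mary_partitions m k n. 1 \<notin># P} =
    (if m dvd n then image_mset ((*) m) ` mary_partitions m k (n div m) else {})"
proof -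
  have *: "m dvd n \<and> P \<in> image_mset ((*) m) ` mary_partitions m k (n div m)"
    if P: "P \<in> mary_partitions m k n" "1 \<notin># P" for P
  proof -
    define Q where "Q = image_mset (\<lambda>x. x div m) P"
    note pow = part_of_mary_partition_without_one[OF P]
    have "image_mset ((*) m) Q = image_mset (\<lambda>x. m * (x div m)) P"
      by (simp add: Q_def multiset.map_comp o_def)
    also have "\<dots> = image_mset (\<lambda>x. x) P"
      using pow by (intro image_mset_cong) fastforce
    finally have PQ: "P = image_mset ((*) m) Q" by simp
    then have n: "n = m * sum_mset Q"
      using P by (auto simp: mary_partitions_def sum_mset_image_mult)
    moreover have "\<exists>j. y = m ^ j" if "y \<in># Q" for y
      using that pow assms by (fastforce simp: Q_def)
    ultimately have "Q \<in> mary_partitions m k (n div m)"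
      using P assms PQ by (auto simp: mary_partitions_def)
    with PQ n show ?thesis by auto
  qed
  have "image_mset ((*) m) Q \<in> mary_partitions m k n \<and> 1 \<notin># image_mset ((*) m) Q"
    if "m dvd n" "Q \<in> mary_partitions m k (n div m)" for Q
  proof -
    have "\<exists>j. m * y = m ^ j" if "y \<in># Q" for y
    proof -
      obtain j where "y = m ^ j"
        using \<open>Q \<in> _\<close> \<open>y \<in># Q\<close> by (auto simp: mary_partitions_def)
      then show ?thesis by (intro exI[of _ "Suc j"]) simp
    qed
    then show ?thesis
      using that assms by (auto simp: mary_partitions_def sum_mset_image_mult)
  qed
  with * show ?thesis by auto
qed

lemma mary_count_Suc_Suc:
  assumes "m \<ge> 2"
  shows "mary_count m (Suc k) (Suc n) =
    mary_count m k n + (if m dvd Suc n then mary_count m (Suc k) (Suc n div m) else 0)"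
proof -
  let ?A = "mary_partitions m (Suc k) (Suc n)"
  have "inj (image_mset ((*) m))"
    using assms by (intro multiset.inj_map) (auto intro!: injI)
  then have "card {P \<in> ?A. 1 \<notin># P} =
      (if m dvd Suc n then mary_count m (Suc k) (Suc n div m) else 0)"
    unfolding mary_partitions_without_one[OF assms]
    by (auto simp: mary_count_def card_image inj_on_subset)
  moreover have "card {P \<in> ?A. 1 \<in># P} = mary_count m k n"
    unfolding mary_partitions_with_one by (simp add: mary_count_def card_image inj_on_def)
  moreover have "card ?A = card {P \<in> ?A. 1 \<in># P} + card {P \<in> ?A. 1 \<notin># P}"
    by (subst card_Un_disjoint[symmetric])
       (auto simp: finite_mary_partitions intro!: arg_cong[of _ _ card])
  ultimately show ?thesis by (simp add: mary_count_def)
qed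

lemma mary_count_0_left: "mary_count m 0 n = (if n = 0 then 1 else 0)"
proof -
  have "mary_partitions m 0 n = (if n = 0 then {{#}} else {})"
    by (auto simp: mary_partitions_def)
  then show ?thesis by (simp add: mary_count_def)
qed

lemma mary_count_0_right:
  assumes "m \<ge> 2"
  shows "mary_count m k 0 = (if k = 0 then 1 else 0)"
proof -
  have "P = {#}" if P: "P \<in> mary_partitions m k 0" for P
  proof (rule ccontr)
    assume "P \<noteq> {#}"
    then obtain x where "x \<in># P" by auto
    with P have "x = 0" "\<exists>j. x = m ^ j" by (auto simp: mary_partitions_def)
    with assms show False by auto
  qed
  moreover have "{#} \<in> mary_partitions m k 0 \<longleftrightarrow> k = 0"
    by (auto simp: mary_partitions_def)
  ultimately have "mary_partitions m k 0 = (if k = 0 then {{#}} else {})"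
    by auto
  then show ?thesis by (simp add: mary_count_def)
qed

section \<open>Counts along residue classes modulo \<open>m\<close>\<close>

lemma not_dvd_mult_add:
  fixes m N i :: nat
  assumes "0 < i" "i < m"
  shows "\<not> m dvd m * N + i"
  using assms by (simp add: dvd_add_right_iff nat_dvd_not_less)

text \<open>None of \<open>m * N + 1\<close>, ..., \<open>m * N + i\<close> is divisible by
  \<open>m\<close>, so at each of them the recursion can only remove a part 1.\<close>

lemma mary_count_add_residue:
  assumes "m \<ge> 2" "i < m"
  shows "mary_count m (k + i) (m * N + i) = mary_count m k (m * N)"
  using assms(2)
proof (induction i)
  case (Suc i)
  then have "\<not> m dvd Suc (m * N + i)" using not_dvd_mult_add[of "Suc i" m N] by simp
  with Suc assms(1) show ?case by (simp add: mary_count_Suc_Suc)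
qed simp

text \<open>All parts except the ones vanish modulo \<open>m\<close>, so at least \<open>i\<close>
  ones are needed. Removing \<open>k\<close> of them would leave no parts but a positive
  sum.\<close>

lemma mary_count_eq_0_if_less_residue:
  assumes "m \<ge> 2" "i < m" "k < i"
  shows "mary_count m k (m * N + i) = 0"
proof -
  have "mary_count m k (m * N + i) = mary_count m 0 (m * N + (i - k))"
    using assms(2,3)
  proof (induction k arbitrary: i)
    case (Suc k)
    then obtain i' where i: "i = Suc i'" by (cases i) auto
    then have "\<not> m dvd Suc (m * N + i')" using not_dvd_mult_add[of i m N] Suc by simp
    with Suc.IH[of i'] Suc.prems i assms(1) show ?case by (simp add: mary_count_Suc_Suc)
  qed simp
  with assms show ?thesis by (simp add: mary_count_0_left)
qed

lemma mary_count_mult: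
  assumes "m \<ge> 2" "N > 0"
  shows "mary_count m k (m * N) =
    mary_count m k N + (if m \<le> k then mary_count m (k - m) (m * (N - 1)) else 0)"
proof (cases k)
  case 0
  with assms show ?thesis by (simp add: mary_count_0_left)
next
  case (Suc k')
  have eq: "m * N = Suc (m * (N - 1) + (m - 1))"
    using assms by (cases N) auto
  \<comment> \<open>Removing one part 1 leaves residue \<open>m - 1\<close>, which forces the
    removal of \<open>m - 1\<close> further ones.\<close>
  have "mary_count m k (m * N) =
      mary_count m k' (m * (N - 1) + (m - 1)) + mary_count m k N"
    using mary_count_Suc_Suc[OF assms(1), of k' "m * (N - 1) + (m - 1)"] assms
    unfolding eq[symmetric] Suc by simp
  moreover have "mary_count m k' (m * (N - 1) + (m - 1)) =
      (if m \<le> k then mary_count m (k - m) (m * (N - 1)) else 0)"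
    using mary_count_eq_0_if_less_residue[of m "m - 1" k' "N - 1"]
      mary_count_add_residue[of m "m - 1" "k - m" "N - 1"] assms Suc
    by auto
  ultimately show ?thesis by simp
qed

section \<open>Powers of \<open>m\<close> dividing \<open>n\<close>, and the vanishing of most
  terms\<close>

lemma mary_count_mult_pow:
  assumes "m \<ge> 2" "M > 0"
  shows "mary_count m k (m ^ s * M) = mary_count m k M +
    (if m \<le> k then \<Sum>t<s. mary_count m (k - m) (m * (m ^ t * M - 1)) else 0)"
proof (induction s)
  case (Suc s)
  \<comment> \<open>The new summand is the one with index \<open>t = s\<close>. Its argument is
    \<open>m ^ Suc s * M - m\<close>, so indices start at 0.\<close>
  have "mary_count m k (m * (m ^ s * M)) = mary_count m k (m ^ s * M) +
      (if m \<le> k then mary_count m (k - m) (m * (m ^ s * M - 1)) else 0)"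
    using assms by (intro mary_count_mult) auto
  with Suc show ?case by (simp add: mult.assoc)
qed simp

text \<open>In a partition of \<open>m * N\<close> the number of ones is a multiple of
  \<open>m\<close>. Merging them in groups of \<open>m\<close> and then dividing all parts by
  \<open>m\<close> partitions \<open>N\<close> without increasing the number of parts.\<close>

lemma mary_count_mult_nonzero:
  assumes "m \<ge> 2" "mary_count m k (m * N) \<noteq> 0"
  shows "\<exists>k'\<le>k. mary_count m k' N \<noteq> 0"
  using assms(2)
proof (induction N arbitrary: k)
  case (Suc N)
  show ?case
  proof (cases "mary_count m k (Suc N) = 0")
    case True
    with Suc.prems mary_count_mult[OF assms(1), of "Suc N" k]
    have k: "m \<le> k" "mary_count m (k - m) (m * N) \<noteq> 0" by (auto split: if_splits)
    from Suc.IH[OF k(2)] obtain k' where k': "k' \<le> k - m" "mary_count m k' N \<noteq> 0" by auto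
    then have "mary_count m (Suc k') (Suc N) \<noteq> 0"
      by (simp add: mary_count_Suc_Suc[OF assms(1)])
    moreover have "Suc k' \<le> k" using k k' assms(1) by linarith
    ultimately show ?thesis by blast
  qed auto
qed auto

text \<open>The \<open>t\<close> lowest base-\<open>m\<close> digits are all \<open>m - 1\<close>.
  Each costs \<open>m - 1\<close> ones, and the division by \<open>m\<close> that exposes the next
  digit does not increase the number of parts.\<close>

lemma mary_count_nonzero_imp_le:
  assumes "m \<ge> 2" "M > 0" "mary_count m k (m ^ t * M - 1) \<noteq> 0"
  shows "t * (m - 1) \<le> k"
  using assms(3)
proof (induction t arbitrary: k)
  case (Suc t)
  have "m ^ t * M > 0" using assms by simp
  then obtain N where N: "m ^ t * M = Suc N" using gr0_implies_Suc by blast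
  then have eq: "m ^ Suc t * M - 1 = m * N + (m - 1)"
    using assms(1) by (simp add: mult.assoc)
  have k: "m - 1 \<le> k"
    using mary_count_eq_0_if_less_residue[of m "m - 1" k N] assms(1) Suc.prems
    unfolding eq by force
  then have "mary_count m (k - (m - 1)) (m * N) \<noteq> 0"
    using mary_count_add_residue[of m "m - 1" "k - (m - 1)" N] assms(1) Suc.prems
    unfolding eq by simp
  then obtain k' where "k' \<le> k - (m - 1)" "mary_count m k' N \<noteq> 0"
    using mary_count_mult_nonzero[OF assms(1)] by blast
  then have "t * (m - 1) \<le> k - (m - 1)" using Suc.IH[of k'] N by simp
  with k show ?case by simp
qed simp

section \<open>The majorant and the bound uniform in \<open>n\<close>\<close>

text \<open>The guard \<open>m < 2\<close> only serves termination.\<close>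

function mary_majorant :: "nat \<Rightarrow> nat \<Rightarrow> nat" where
  "mary_majorant m k = (if k < m \<or> m < 2 then 1
     else mary_majorant m (k - 1) + (k - 1) div (m - 1) * mary_majorant m (k - m))"
  by auto
termination by (relation "measure snd") auto

declare mary_majorant.simps [simp del]

lemma mary_majorant_small: "k < m \<Longrightarrow> mary_majorant m k = 1"
  by (simp add: mary_majorant.simps)

lemma mary_majorant_rec:
  "2 \<le> m \<Longrightarrow> m \<le> k \<Longrightarrow> mary_majorant m k =
     mary_majorant m (k - 1) + (k - 1) div (m - 1) * mary_majorant m (k - m)"
  by (subst mary_majorant.simps) simp

lemma mono_mary_majorant: "mono (mary_majorant m)"
proof (rule incseq_SucI)
  show "mary_majorant m k \<le> mary_majorant m (Suc k)" for k
    by (subst (2) mary_majorant.simps) (auto simp: mary_majorant.simps[of m k])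
qed

lemma mary_majorant_pos: "1 \<le> mary_majorant m k"
proof -
  have "1 = mary_majorant m 0" by (subst mary_majorant.simps) auto
  also have "\<dots> \<le> mary_majorant m k" by (intro monoD[OF mono_mary_majorant]) simp
  finally show ?thesis .
qed

lemma exists_power_decomposition:
  fixes m n :: nat
  assumes "m \<ge> 2" "n > 0"
  shows "\<exists>s M. n = m ^ s * M \<and> \<not> m dvd M"
  using assms(2)
proof (induction n rule: less_induct)
  case (less n)
  show ?case
  proof (cases "m dvd n")
    case True
    then obtain N where N: "n = m * N" by auto
    with less.prems assms(1) have "N < n" "N > 0" by auto
    from less.IH[OF this] obtain s M where "N = m ^ s * M" "\<not> m dvd M" by blast
    with N show ?thesis by (intro exI[of _ "Suc s"] exI[of _ M]) simp
  next
    case False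
    then show ?thesis by (intro exI[of _ 0] exI[of _ n]) simp
  qed
qed

lemma mary_count_le_majorant:
  assumes "m \<ge> 2"
  shows "mary_count m k n \<le> mary_majorant m k"
proof (induction k arbitrary: n rule: less_induct)
  case (less k)
  let ?B = "mary_majorant m"
  \<comment> \<open>A nonzero residue forces at least one part 1, so the induction hypothesis
    applies to fewer parts.\<close>
  have not_dvd: "mary_count m k M \<le> ?B (k - 1)" if "\<not> m dvd M" for M
  proof (cases "k < M mod m")
    case True
    with assms mary_count_eq_0_if_less_residue[of m "M mod m" k "M div m"] show ?thesis by simp
  next
    case False
    have "M mod m > 0" using that by (simp add: dvd_eq_mod_eq_0)
    have "mary_count m k M = mary_count m (k - M mod m) (m * (M div m))"
      using mary_count_add_residue[of m "M mod m" "k - M mod m" "M div m"] False assms by simp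
    also have "\<dots> \<le> ?B (k - M mod m)"
      using False \<open>M mod m > 0\<close> by (intro less.IH) auto
    also have "\<dots> \<le> ?B (k - 1)"
      using \<open>M mod m > 0\<close> by (intro monoD[OF mono_mary_majorant]) auto
    finally show ?thesis .
  qed
  show ?case
  proof (cases "n = 0")
    case True
    with assms mary_majorant_pos[of m k] show ?thesis by (auto simp: mary_count_0_right)
  next
    case False
    then obtain s M where n: "n = m ^ s * M" and M: "\<not> m dvd M"
      using exists_power_decomposition[OF assms] by blast
    from M have M0: "M > 0" by (cases M) auto
    show ?thesis
    proof (cases "k < m")
      case True
      with not_dvd[OF M] mary_count_mult_pow[OF assms M0, of k s] n show ?thesis
        by (simp add: mary_majorant_small)
    next
      case False
      let ?f = "\<lambda>t. mary_count m (k - m) (m * (m ^ t * M - 1))"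
      \<comment> \<open>For \<open>k \<ge> m\<close> this is the number of \<open>t\<close> with
        \<open>t * (m - 1) \<le> k - m\<close>, the only indices with a nonzero term. It does not
        depend on \<open>s\<close>.\<close>
      define T where "T = (k - 1) div (m - 1)"
      have less_T: "t < T" if f: "0 < mary_count m (k - m) (m * (m ^ t * M - Suc 0))" for t
      proof -
        obtain k' where k': "k' \<le> k - m" "mary_count m k' (m ^ t * M - 1) \<noteq> 0"
          using mary_count_mult_nonzero[OF assms] f by fastforce
        then have "t * (m - 1) \<le> k - m"
          using mary_count_nonzero_imp_le[OF assms M0] by fastforce
        then have "Suc t * (m - 1) \<le> k - 1" using False assms by simp
        then have "Suc t \<le> T" using assms by (simp add: T_def less_eq_div_iff_mult_less_eq)
        then show ?thesis by simp
      qed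
      have "(\<Sum>t<s. ?f t) = (\<Sum>t\<in>{..<s} \<inter> {..<T}. ?f t)"
        by (intro sum.mono_neutral_right) (auto dest: less_T)
      also have "\<dots> \<le> of_nat (card ({..<s} \<inter> {..<T})) * ?B (k - m)"
        using False assms by (intro sum_bounded_above less.IH) auto
      also have "\<dots> \<le> T * ?B (k - m)"
        using card_mono[of "{..<T}" "{..<s} \<inter> {..<T}"] by simp
      finally have "mary_count m k n \<le> ?B (k - 1) + T * ?B (k - m)"
        using not_dvd[OF M] mary_count_mult_pow[OF assms M0, of k s] n False by simp
      also have "\<dots> = ?B k"
        using mary_majorant_rec[OF assms, of k] False by (simp add: T_def)
      finally show ?thesis .
    qed
  qed
qed

section \<open>From the majorant to the product\<close>

lemma mary_majorant_le_diff:
  assumes "m \<ge> 2" "m \<le> k"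
  shows "(m - 1) * mary_majorant m k \<le> m * k * mary_majorant m (k - m)"
proof -
  let ?B = "mary_majorant m"
  define x where "x = k - m"
  \<comment> \<open>Each of the \<open>j\<close> increments, scaled by \<open>m - 1\<close>, is at
    most \<open>(x + m - 1) * ?B x\<close>.\<close>
  have "(m - 1) * ?B (x + j) \<le> (m - 1 + j * (x + m - 1)) * ?B x" if "j \<le> m" for j
    using that
  proof (induction j)
    case (Suc j)
    have step: "(m - 1) * ?B (x + Suc j) \<le> (m - 1) * ?B (x + j) + (x + j) * ?B x"
    proof (cases "m \<le> x + Suc j")
      case True
      have "(m - 1) * ?B (x + Suc j) =
          (m - 1) * ?B (x + j) + (m - 1) * ((x + j) div (m - 1)) * ?B (x + Suc j - m)"
        using mary_majorant_rec[OF assms(1) True] by (simp add: algebra_simps)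
      \<comment> \<open>The factor \<open>m - 1\<close> absorbs the rounded quotient, and
        \<open>Suc j \<le> m\<close> keeps the argument of \<open>?B\<close> at most
        \<open>x\<close>.\<close>
      also have "\<dots> \<le> (m - 1) * ?B (x + j) + (x + j) * ?B x"
        using Suc.prems
        by (intro add_mono mult_mono monoD[OF mono_mary_majorant]) auto
      finally show ?thesis .
    qed (simp add: mary_majorant_small)
    also have "\<dots> \<le> (m - 1 + j * (x + m - 1)) * ?B x + (x + m - 1) * ?B x"
      using Suc by (intro add_mono mult_right_mono) auto
    also have "\<dots> = (m - 1 + Suc j * (x + m - 1)) * ?B x"
      by (simp add: add_mult_distrib)
    finally show ?case .
  qed simp
  from this[of m] have "(m - 1) * ?B k \<le> (m - 1 + m * (k - 1)) * ?B x"
    using assms by (simp add: x_def)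
  also have "m - 1 + m * (k - 1) \<le> m * k"
    using assms by (cases k) auto
  finally show ?thesis by (simp add: x_def)
qed

lemma mary_majorant_le_prod:
  assumes "m \<ge> 2"
  shows "real (mary_majorant m k) \<le>
    (real m / (real m - 1)) ^ (k div m) * (\<Prod>j<k div m. real k - real j * real m)"
proof (induction k rule: less_induct)
  case (less k)
  show ?case
  proof (cases "k < m")
    case True
    then show ?thesis by (simp add: mary_majorant_small)
  next
    case False
    define c where "c = real m / (real m - 1)"
    define q where "q = (k - m) div m"
    have q: "k div m = Suc q" using False assms by (simp add: q_def le_div_geq)
    have "real ((m - 1) * mary_majorant m k) \<le> real (m * k * mary_majorant m (k - m))"
      using mary_majorant_le_diff[OF assms, of k] False by (simp only: of_nat_le_iff)
    then have "real (mary_majorant m k) \<le> c * real k * real (mary_majorant m (k - m))"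
      using assms by (simp add: c_def field_simps of_nat_diff)
    also have "\<dots> \<le> c * real k * (c ^ q * (\<Prod>j<q. real (k - m) - real j * real m))"
      using less.IH[of "k - m"] False assms
      by (intro mult_left_mono) (auto simp: c_def q_def)
    \<comment> \<open>Replacing \<open>k\<close> by \<open>k - m\<close> shifts the factors by one;
      the freed factor \<open>j = 0\<close> is \<open>real k\<close>.\<close>
    also have "(\<Prod>j<q. real (k - m) - real j * real m) =
        (\<Prod>j<q. real k - real (Suc j) * real m)"
      using False by (intro prod.cong) (auto simp: algebra_simps of_nat_diff)
    also have "c * real k * (c ^ q * (\<Prod>j<q. real k - real (Suc j) * real m)) =
        c ^ Suc q * (\<Prod>j<Suc q. real k - real j * real m)"
      by (subst prod.lessThan_Suc_shift) simp
    finally show ?thesis by (simp add: q c_def)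
  qed
qed

theorem theorem6p3:
  fixes m k :: nat
  assumes "m \<ge> 2"
  shows "(\<forall>n i :: nat. i < m \<longrightarrow> [n = i] (mod m) \<longrightarrow>
            real (mary_count m k n) \<le>
              (real m / (real m - 1)) powi \<lfloor>(real k - real i) / real m\<rfloor> *
              (\<Prod>j = 0..\<lfloor>(real k - real i) / real m\<rfloor> - 1.
                 (real k - real i - real_of_int j * real m)))
         \<and> Bseq (\<lambda>n. real (mary_count m k n))"
proof (intro conjI allI impI)
  fix n i :: nat
  assume i: "i < m" and "[n = i] (mod m)"
  then have "n mod m = i" by (simp add: cong_def)
  then have n: "n = m * (n div m) + i" by (metis mult_div_mod_eq)
  let ?c = "real m / (real m - 1)" and ?z = "\<lfloor>(real k - real i) / real m\<rfloor>"
  show "real (mary_count m k n) \<le>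
      ?c powi ?z * (\<Prod>j = 0..?z - 1. (real k - real i - real_of_int j * real m))"
  proof (cases "k < i")
    case True
    \<comment> \<open>The product is then empty, hence 1, and the power has a negative exponent but
      is still nonnegative, while the count is 0.\<close>
    then have "?z < 0" using assms by (simp add: floor_less_iff divide_neg_pos)
    moreover have "mary_count m k n = 0"
      using mary_count_eq_0_if_less_residue[OF assms i True, of "n div m"] n by simp
    moreover have "?c powi ?z \<ge> 0" using assms by (intro zero_le_power_int) auto
    ultimately show ?thesis by simp
  next
    case False
    define l where "l = k - i"
    have l: "real k - real i = real l" using False by (simp add: l_def of_nat_diff)
    have z: "\<lfloor>real l / real m\<rfloor> = int (l div m)" by (rule floor_divide_of_nat_eq)
    have "{0..int (l div m) - 1} = int ` {..<l div m}"
      by (auto simp: lessThan_atLeast0 image_int_atLeastLessThan)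
    then have prod: "(\<Prod>j = 0..int (l div m) - 1. real l - real_of_int j * real m) =
        (\<Prod>j<l div m. real l - real j * real m)"
      by (simp add: prod.reindex)
    have "mary_count m k n = mary_count m l (m * (n div m))"
      using mary_count_add_residue[OF assms i, of l "n div m"] n False by (simp add: l_def)
    then have "real (mary_count m k n) \<le> real (mary_majorant m l)"
      using mary_count_le_majorant[OF assms] by simp
    also note mary_majorant_le_prod[OF assms]
    finally show ?thesis unfolding l z prod by simp
  qed
next
  show "Bseq (\<lambda>n. real (mary_count m k n))"
    \<comment> \<open>The majorant depends on \<open>m\<close> and \<open>k\<close> only, so it
      bounds the whole sequence.\<close>
    using mary_count_le_majorant[OF assms, of k]
    by (intro BseqI'[of _ "real (mary_majorant m k)"]) simp
qed

end
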